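(* Every crowded monotonically normal topological space is $\omega$-resolvable.
   Context: A topological space is crowded if it has no isolated points. A space is $\kappa$-resolvable if it contains $\kappa$ many pairwise disjoint dense subsets. For a topological space $X$ with topology $\tau(X)$, let $\mathcal{M}(X)=\{\langle x,U\rangle\in X\times\tau(X): x\in U\}$. The space $X$ is monotonically normal if it is $T_1$ and there is a function $H:\mathcal{M}(X)\to\tau(X)$ (a monotone normality operator) such that (1) $x\in H(x,U)\subseteq U$ for each $\langle x,U\rangle\in\mathcal{M}(X)$; (2) if $H(x,U)\cap H(y,V)\neq\emptyset$ then $x\in V$ or $y\in U$. *)

theory Defs
  imports "HOL-Analysis.Analysis"
begin

definition crowded_space :: "'a topology \<Rightarrow> bool" where
  "crowded_space X \<longleftrightarrow> \<not> (\<exists>x \<in> topspace X. openin X {x})"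

definition dense_in_space :: "'a topology \<Rightarrow> 'a set \<Rightarrow> bool" where
  "dense_in_space X D \<longleftrightarrow> D \<subseteq> topspace X \<and> X closure_of D = topspace X"

(* The cardinal kappa is given by any index set K of that cardinality, and the dense sets
   form a family indexed by K.  In a nonempty space, disjoint dense sets with different indices
   are different (lemma resolvable_space_distinct), so the family consists of kappa many sets;
   the empty space counts as resolvable for every kappa. *)
definition resolvable_space :: "'i set \<Rightarrow> 'a topology \<Rightarrow> bool" where
  "resolvable_space K X \<longleftrightarrow>
     (\<exists>D :: 'i \<Rightarrow> 'a set. (\<forall>i\<in>K. dense_in_space X (D i)) \<and> disjoint_family_on D K)"

abbreviation omega_resolvable_space :: "'a topology \<Rightarrow> bool" where
  "omega_resolvable_space X \<equiv> resolvable_space (UNIV :: nat set) X"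

definition pointed_opens :: "'a topology \<Rightarrow> ('a \<times> 'a set) set" where
  "pointed_opens X = {(x, U). x \<in> topspace X \<and> openin X U \<and> x \<in> U}"

definition monotone_normality_operator ::
    "'a topology \<Rightarrow> ('a \<times> 'a set \<Rightarrow> 'a set) \<Rightarrow> bool" where
  "monotone_normality_operator X H \<longleftrightarrow>
     H \<in> pointed_opens X \<rightarrow> {W. openin X W} \<and>
     (\<forall>(x, U) \<in> pointed_opens X. x \<in> H (x, U) \<and> H (x, U) \<subseteq> U) \<and>
     (\<forall>(x, U) \<in> pointed_opens X. \<forall>(y, V) \<in> pointed_opens X.
        H (x, U) \<inter> H (y, V) \<noteq> {} \<longrightarrow> x \<in> V \<or> y \<in> U)"

definition monotonically_normal_space :: "'a topology \<Rightarrow> bool" where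
  "monotonically_normal_space X \<longleftrightarrow>
     t1_space X \<and> (\<exists>H. monotone_normality_operator X H)"

lemma resolvable_space_distinct:
  assumes "topspace X \<noteq> {}" "\<forall>i\<in>K. dense_in_space X (D i)" "disjoint_family_on D K"
  shows "inj_on D K"
proof (rule inj_onI)
  fix i j assume "i \<in> K" "j \<in> K" "D i = D j"
  moreover have "D i \<noteq> {}"
    using assms(1,2) \<open>i \<in> K\<close> by (metis closure_of_empty dense_in_space_def)
  ultimately show "i = j"
    using assms(3) by (auto simp: disjoint_family_on_def)
qed

end

theory Submission
  imports Defs
begin

text \<open>A maximal disjoint family of pairs \<open>(y, V)\<close> with \<open>y \<in> V \<subseteq> H (y, U - {p})\<close> has \<open>p\<close> in the
  closure of its centres \<open>y\<close>: by maximality some \<open>V\<close> meets \<open>H (p, N)\<close>, and then \<open>y \<in> N\<close>, since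
  \<open>p \<notin> U - {p}\<close>. Hence every point is an accumulation point of a set whose points are separated
  by disjoint open sets. Iterating this inside the separating sets gives disjoint levels
  \<open>D 0, D 1, \<dots>\<close>, each in the closure of all later ones, so the unions over infinitely
  many disjoint infinite sets of levels are dense in the union of all levels. Such subspaces exist
  in every nonempty open set, and a maximal disjoint family of them has a dense union.\<close>

section \<open>Maximal families\<close>

text \<open>Zorn's lemma applies because two elements of the union of a chain lie in a common
  member. \<open>R\<close> need not be symmetric, so a candidate is tested in both orders. Both
  maximal disjoint families below come from here.\<close>

lemma maximal_pairwise_subset:
  obtains M where "M \<subseteq> A" "pairwise R M"
    "\<And>x. x \<in> A \<Longrightarrow> (\<And>y. y \<in> M \<Longrightarrow> R x y \<and> R y x) \<Longrightarrow> x \<in> M"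
proof -
  define F where "F = {S. S \<subseteq> A \<and> pairwise R S}"
  have "\<exists>M\<in>F. \<forall>S\<in>F. M \<subseteq> S \<longrightarrow> S = M"
  proof (rule subset_Zorn')
    fix C assume C: "subset.chain F C"
    then have sub: "C \<subseteq> F" and lin: "\<And>S T. S \<in> C \<Longrightarrow> T \<in> C \<Longrightarrow> S \<subseteq> T \<or> T \<subseteq> S"
      by (auto simp: subset_chain_def)
    have "pairwise R (\<Union>C)"
    proof (rule pairwiseI)
      fix x y assume "x \<in> \<Union>C" "y \<in> \<Union>C" "x \<noteq> y"
      then obtain S where "S \<in> C" "x \<in> S" "y \<in> S"
        using lin by blast
      then show "R x y"
        using sub \<open>x \<noteq> y\<close> by (auto simp: F_def pairwise_def)
    qed
    then show "\<Union>C \<in> F"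
      using sub by (auto simp: F_def)
  qed
  then obtain M where M: "M \<in> F" and max: "\<And>S. S \<in> F \<Longrightarrow> M \<subseteq> S \<Longrightarrow> S = M"
    by blast
  show thesis
  proof
    show "M \<subseteq> A" "pairwise R M"
      using M by (auto simp: F_def)
    fix x assume "x \<in> A" "\<And>y. y \<in> M \<Longrightarrow> R x y \<and> R y x"
    then have "insert x M \<in> F"
      using M by (auto simp: F_def pairwise_insert)
    then show "x \<in> M"
      using max by blast
  qed
qed

section \<open>Accumulation points of separated sets\<close>

text \<open>Centres are kept together with their neighbourhoods, because the next level is built
  inside these. Distinct pairs have distinct centres, since their second components are
  disjoint.\<close>

definition open_separation :: "'a topology \<Rightarrow> ('a \<times> 'a set) set \<Rightarrow> bool" where
  "open_separation X S \<longleftrightarrow>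
     (\<forall>(x, U)\<in>S. openin X U \<and> x \<in> U) \<and> pairwise (\<lambda>s t. disjnt (snd s) (snd t)) S"

definition accumulates_separated :: "'a topology \<Rightarrow> bool" where
  "accumulates_separated X \<longleftrightarrow> (\<forall>p U. openin X U \<and> p \<in> U \<longrightarrow>
     (\<exists>S. open_separation X S \<and> (\<forall>(y, V)\<in>S. V \<subseteq> U - {p}) \<and> p \<in> X closure_of (fst ` S)))"

lemma monotonically_normal_accumulates_separated:
  assumes "crowded_space X" "monotonically_normal_space X"
  shows "accumulates_separated X"
  unfolding accumulates_separated_def
proof (intro allI impI, elim conjE)
  fix p U assume U: "openin X U" "p \<in> U"
  from assms(2) obtain H where t1: "t1_space X" and H: "monotone_normality_operator X H"
    by (auto simp: monotonically_normal_space_def)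
  have po: "(x, V) \<in> pointed_opens X" if "openin X V" "x \<in> V" for x V
    using that openin_subset by (fastforce simp: pointed_opens_def)
  have opn: "openin X (H (x, V))" "x \<in> H (x, V)" "H (x, V) \<subseteq> V" if "openin X V" "x \<in> V" for x V
    using H po[OF that] unfolding monotone_normality_operator_def Pi_iff by blast+
  have meet: "x \<in> V' \<or> y \<in> V"
    if "openin X V" "x \<in> V" "openin X V'" "y \<in> V'" "H (x, V) \<inter> H (y, V') \<noteq> {}" for x y V V'
    using H po[OF that(1,2)] po[OF that(3,4)] that(5)
    unfolding monotone_normality_operator_def by blast
  have pX: "p \<in> topspace X"
    using U openin_subset by blast
  have del: "openin X (V - {p})" if "openin X V" for V
    using t1 pX that by (simp add: openin_diff t1_space_closedin_singleton)
  define W where "W = U - {p}"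
  have W: "openin X W"
    unfolding W_def by (rule del[OF U(1)])
  \<comment> \<open>\<open>V\<close> may be smaller than \<open>H (y, W)\<close>, so that a
    candidate can be shrunk to avoid the members of a given family.\<close>
  define A where "A = {(y, V). openin X V \<and> y \<in> V \<and> y \<in> W \<and> V \<subseteq> H (y, W)}"
  obtain S where S: "S \<subseteq> A" "pairwise (\<lambda>s t. disjnt (snd s) (snd t)) S"
    and max: "\<And>s. s \<in> A \<Longrightarrow>
      (\<And>t. t \<in> S \<Longrightarrow> disjnt (snd s) (snd t) \<and> disjnt (snd t) (snd s)) \<Longrightarrow> s \<in> S"
    using maximal_pairwise_subset by blast
  have "open_separation X S"
    using S by (auto simp: open_separation_def A_def)
  moreover have "\<forall>(y, V)\<in>S. V \<subseteq> U - {p}"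
    using S(1) opn(3)[OF W] by (fastforce simp: A_def W_def)
  moreover have "p \<in> X closure_of (fst ` S)"
    unfolding in_closure_of
  proof (intro conjI allI impI pX, elim conjE)
    fix N assume N: "p \<in> N" "openin X N"
    then have NU: "openin X (N \<inter> U)" "p \<in> N \<inter> U"
      using U by auto
    \<comment> \<open>Removing \<open>p\<close> leaves an open set by T1, and a nonempty one by
      crowdedness; its points lie in \<open>W\<close> and can serve as new centres.\<close>
    define N' where "N' = H (p, N \<inter> U) - {p}"
    have N': "openin X N'"
      unfolding N'_def by (rule del[OF opn(1)[OF NU]])
    have "N' \<noteq> {}"
    proof
      assume "N' = {}"
      then have "H (p, N \<inter> U) = {p}"
        using opn(2)[OF NU] by (auto simp: N'_def)
      then show False
        using opn(1)[OF NU] assms(1) pX by (auto simp: crowded_space_def)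
    qed
    then obtain y where y: "y \<in> N'"
      by blast
    then have yW: "y \<in> W"
      using opn(3)[OF NU] by (auto simp: N'_def W_def)
    \<comment> \<open>Otherwise maximality puts \<open>(y, N' \<inter> H (y, W))\<close> into
      \<open>S\<close>, although its second component meets \<open>N'\<close> in
      \<open>y\<close>.\<close>
    have "\<exists>t\<in>S. \<not> disjnt N' (snd t)"
    proof (rule ccontr)
      assume no: "\<not> ?thesis"
      let ?V = "N' \<inter> H (y, W)"
      have "(y, ?V) \<in> A"
        using N' y yW opn[OF W yW] by (auto simp: A_def)
      moreover have "disjnt (snd (y, ?V)) (snd t) \<and> disjnt (snd t) (snd (y, ?V))" if "t \<in> S" for t
        using no that by (auto simp: disjnt_def)
      ultimately have "(y, ?V) \<in> S"
        by (rule max)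
      then have "disjnt N' ?V"
        using no by fastforce
      then show False
        using y opn(2)[OF W yW] by (auto simp: disjnt_def)
    qed
    then obtain z V where z: "(z, V) \<in> S" "\<not> disjnt N' V"
      by auto
    then have zW: "z \<in> W" "V \<subseteq> H (z, W)"
      using S(1) by (auto simp: A_def)
    have "p \<in> W \<or> z \<in> N \<inter> U"
      using meet[OF NU W zW(1)] z(2) zW(2) by (auto simp: disjnt_def N'_def)
    then show "\<exists>y. y \<in> fst ` S \<and> y \<in> N"
      using z(1) by (force simp: W_def)
  qed
  ultimately show "\<exists>S. open_separation X S \<and> (\<forall>(y, V)\<in>S. V \<subseteq> U - {p}) \<and> p \<in> X closure_of (fst ` S)"
    by blast
qed

section \<open>Resolvable subspaces from levels\<close>

text \<open>This is resolvability of the subspace \<open>Y\<close>, expressed by closures in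
  \<open>X\<close>: the closure within \<open>Y\<close> is the trace of the closure in
  \<open>X\<close>.\<close>

definition omega_resolvable_subset :: "'a topology \<Rightarrow> 'a set \<Rightarrow> bool" where
  "omega_resolvable_subset X Y \<longleftrightarrow> (\<exists>f :: nat \<Rightarrow> 'a set. disjoint_family f \<and>
     (\<forall>n. f n \<subseteq> Y \<and> Y \<subseteq> X closure_of f n))"

lemma omega_resolvable_subset_UN:
  fixes D :: "nat \<Rightarrow> 'a set"
  assumes disj: "disjoint_family D"
    and step: "\<And>n. D n \<subseteq> X closure_of D (Suc n)"
  shows "omega_resolvable_subset X (\<Union>n. D n)"
proof -
  have later: "D m \<subseteq> X closure_of D (Suc n)" if "m \<le> n" for m n
    using that
  proof (induction n)
    case 0
    then show ?case using step[of 0] by simp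
  next
    case (Suc n)
    show ?case
    proof (cases "m = Suc n")
      case False
      then have "D m \<subseteq> X closure_of D (Suc n)"
        using Suc by simp
      also have "\<dots> \<subseteq> X closure_of D (Suc (Suc n))"
        using step closure_of_minimal[OF step closedin_closure_of] by blast
      finally show ?thesis .
    qed (use step in simp)
  qed
  \<comment> \<open>The pairing function splits the levels into infinitely many infinite classes. As
    \<open>m \<le> prod_encode (n, m)\<close>, class \<open>n\<close> has a level beyond
    \<open>m\<close>; \<open>Suc\<close> makes it strictly later, as \<open>later\<close>
    requires.\<close>
  define f where "f n = (\<Union>k. D (Suc (prod_encode (n, k))))" for n
  have "D (Suc (prod_encode (m, k))) \<inter> D (Suc (prod_encode (n, l))) = {}" if "m \<noteq> n" for m n k l
    using disj that by (simp add: disjoint_family_on_def)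
  then have "disjoint_family f"
    unfolding disjoint_family_on_def f_def by blast
  moreover have "D m \<subseteq> X closure_of f n" for m n
  proof -
    have "D m \<subseteq> X closure_of D (Suc (prod_encode (n, m)))"
      by (rule later[OF le_prod_encode_2])
    also have "\<dots> \<subseteq> X closure_of f n"
      by (rule closure_of_mono) (auto simp: f_def)
    finally show ?thesis .
  qed
  ultimately show ?thesis
    unfolding omega_resolvable_subset_def by (intro exI[of _ f]) (auto simp: f_def)
qed

lemma omega_resolvable_subset_in_open:
  assumes "accumulates_separated X" "openin X G" "G \<noteq> {}"
  obtains Y where "Y \<subseteq> G" "Y \<noteq> {}" "omega_resolvable_subset X Y"
proof -
  have "\<forall>s. \<exists>S. openin X (snd s) \<and> fst s \<in> snd s \<longrightarrow> open_separation X S \<and>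
      (\<forall>(y, V)\<in>S. V \<subseteq> snd s - {fst s}) \<and> fst s \<in> X closure_of (fst ` S)"
    using assms(1) unfolding accumulates_separated_def by meson
  then obtain E where E: "\<And>s. openin X (snd s) \<and> fst s \<in> snd s \<longrightarrow> open_separation X (E s) \<and>
      (\<forall>(y, V)\<in>E s. V \<subseteq> snd s - {fst s}) \<and> fst s \<in> X closure_of (fst ` E s)"
    by metis
  obtain p where p: "p \<in> G"
    using assms(3) by blast
  \<comment> \<open>The levels of a tree with root \<open>(p, G)\<close>, in which
    \<open>E s\<close> is the set of children of \<open>s\<close>. Nothing is known about
    \<open>E\<close> at pairs that are not pointed open sets, hence the facts
    \<open>ok\<close>.\<close>
  define L where "L n = ((\<lambda>S. \<Union>s\<in>S. E s) ^^ n) {(p, G)}" for n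
  have L0: "L 0 = {(p, G)}" and LSuc: "L (Suc n) = (\<Union>s\<in>L n. E s)" for n
    by (auto simp: L_def)
  have sep: "open_separation X (L n)" for n
  proof (induction n)
    case 0
    show ?case
      using p assms(2) by (auto simp: L0 open_separation_def)
  next
    case (Suc n)
    have ok: "openin X (snd s) \<and> fst s \<in> snd s" if "s \<in> L n" for s
      using Suc that by (auto simp: open_separation_def)
    have dis: "disjnt (snd s) (snd t)" if "s \<in> L n" "t \<in> L n" "s \<noteq> t" for s t
      using Suc that by (auto simp: open_separation_def pairwise_def)
    have sub: "snd t \<subseteq> snd s" if "s \<in> L n" "t \<in> E s" for s t
      using E[of s] ok[OF that(1)] that(2) by fastforce
    \<comment> \<open>Siblings are disjoint by the choice of \<open>E\<close>; children of different
      parents lie in disjoint sets.\<close>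
    have "disjnt (snd s') (snd t')" if s: "s \<in> L n" "s' \<in> E s" and t: "t \<in> L n" "t' \<in> E t"
      and ne: "s' \<noteq> t'" for s t s' t'
    proof (cases "s = t")
      case True
      then show ?thesis
        using E[of s] ok[OF s(1)] s t ne by (auto simp: open_separation_def pairwise_def)
    next
      case False
      then show ?thesis
        using dis[OF s(1) t(1)] sub[OF s] sub[OF t] by (auto simp: disjnt_def)
    qed
    then have "pairwise (\<lambda>s t. disjnt (snd s) (snd t)) (L (Suc n))"
      unfolding pairwise_def LSuc by blast
    moreover have "openin X V \<and> y \<in> V" if "s \<in> L n" "(y, V) \<in> E s" for s y V
      using E[of s] ok[OF that(1)] that(2) by (auto simp: open_separation_def)
    ultimately show ?case
      by (auto simp: LSuc open_separation_def)
  qed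
  have ok: "openin X (snd s) \<and> fst s \<in> snd s" if "s \<in> L n" for s n
    using sep[of n] that by (auto simp: open_separation_def)
  \<comment> \<open>The witness is the ancestor of \<open>t\<close> at level \<open>n\<close>: its
    children avoid its centre, and sets only shrink further down the tree.\<close>
  have below: "\<exists>s\<in>L n. snd t \<subseteq> snd s - {fst s}" if "t \<in> L (n + Suc k)" for n k t
    using that
  proof (induction k arbitrary: t)
    case 0
    then obtain s where s: "s \<in> L n" "t \<in> E s"
      by (auto simp: LSuc)
    then have "snd t \<subseteq> snd s - {fst s}"
      using E[of s] ok[OF s(1)] by (auto simp: case_prod_beta)
    then show ?case
      using s(1) by blast
  next
    case (Suc k)
    then obtain u where u: "u \<in> L (n + Suc k)" "t \<in> E u"
      by (auto simp: LSuc)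
    then have "snd t \<subseteq> snd u"
      using E[of u] ok[OF u(1)] by (auto simp: case_prod_beta)
    then show ?case
      using Suc.IH[OF u(1)] by blast
  qed
  define D where "D n = fst ` L n" for n
  \<comment> \<open>For a common centre of \<open>s\<close> and \<open>t\<close>, the ancestor
    \<open>u\<close> of \<open>t\<close> at level \<open>m\<close> contains that point off its own
    centre. So \<open>u\<close> differs from \<open>s\<close>, yet their sets meet.\<close>
  have "D m \<inter> D n = {}" if "m < n" for m n
  proof (rule ccontr)
    assume "\<not> ?thesis"
    then obtain s t where st: "s \<in> L m" "t \<in> L n" "fst s = fst t"
      by (fastforce simp: D_def)
    obtain k where "n = m + Suc k"
      using less_imp_Suc_add[OF \<open>m < n\<close>] by auto
    then obtain u where u: "u \<in> L m" "snd t \<subseteq> snd u - {fst u}"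
      using below st(2) by blast
    then have "fst s \<in> snd u" "u \<noteq> s"
      using ok[OF st(2)] st(3) by auto
    then have "\<not> disjnt (snd s) (snd u)"
      using ok[OF st(1)] by (auto simp: disjnt_def)
    then show False
      using sep[of m] st(1) u(1) \<open>u \<noteq> s\<close> by (auto simp: open_separation_def pairwise_def)
  qed
  then have "disjoint_family D"
    unfolding disjoint_family_on_def by (metis inf_commute linorder_neqE_nat)
  moreover have "D n \<subseteq> X closure_of D (Suc n)" for n
  proof
    fix x assume "x \<in> D n"
    then obtain s where s: "s \<in> L n" "x = fst s"
      by (auto simp: D_def)
    then have "x \<in> X closure_of (fst ` E s)"
      using E[of s] ok[OF s(1)] by blast
    moreover have "fst ` E s \<subseteq> D (Suc n)"
      using s(1) by (auto simp: D_def LSuc)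
    ultimately show "x \<in> X closure_of D (Suc n)"
      using closure_of_mono by blast
  qed
  ultimately have "omega_resolvable_subset X (\<Union>n. D n)"
    by (rule omega_resolvable_subset_UN)
  moreover have "D n \<subseteq> G" for n
  proof (cases n)
    case 0
    then show ?thesis using p by (simp add: D_def L0)
  next
    case (Suc k)
    show ?thesis
    proof
      fix x assume "x \<in> D n"
      then obtain t where t: "t \<in> L n" "x = fst t"
        by (auto simp: D_def)
      then show "x \<in> G"
        using below[of t 0 k] ok[OF t(1)] Suc by (auto simp: L0)
    qed
  qed
  moreover have "p \<in> D 0"
    by (simp add: D_def L0)
  ultimately show thesis
    using that[of "\<Union>n. D n"] by blast
qed

section \<open>Gluing disjoint subspaces\<close>

lemma omega_resolvable_space_if_locally:
  assumes local: "\<And>G. openin X G \<Longrightarrow> G \<noteq> {} \<Longrightarrow>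
    \<exists>Y \<subseteq> G. Y \<noteq> {} \<and> omega_resolvable_subset X Y"
  shows "omega_resolvable_space X"
proof -
  obtain M where M: "M \<subseteq> {Y. omega_resolvable_subset X Y}" "pairwise disjnt M"
    and max: "\<And>Y. Y \<in> {Y. omega_resolvable_subset X Y} \<Longrightarrow>
      (\<And>Z. Z \<in> M \<Longrightarrow> disjnt Y Z \<and> disjnt Z Y) \<Longrightarrow> Y \<in> M"
    using maximal_pairwise_subset by blast
  have "\<forall>Y\<in>M. \<exists>f :: nat \<Rightarrow> 'a set. disjoint_family f \<and> (\<forall>n. f n \<subseteq> Y \<and> Y \<subseteq> X closure_of f n)"
    using M(1) by (auto simp: omega_resolvable_subset_def)
  then obtain f :: "'a set \<Rightarrow> nat \<Rightarrow> 'a set" where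
    f: "\<And>Y. Y \<in> M \<Longrightarrow> disjoint_family (f Y)"
      "\<And>Y n. Y \<in> M \<Longrightarrow> f Y n \<subseteq> Y" "\<And>Y n. Y \<in> M \<Longrightarrow> Y \<subseteq> X closure_of f Y n"
    by metis
  have MX: "\<Union>M \<subseteq> topspace X"
    using f(3) closure_of_subset_topspace by fastforce
  have dense: "X closure_of \<Union>M = topspace X"
  proof (rule ccontr)
    assume ne: "X closure_of \<Union>M \<noteq> topspace X"
    define G where "G = topspace X - X closure_of \<Union>M"
    have "openin X G" "G \<noteq> {}"
      using ne closure_of_subset_topspace[of X "\<Union>M"] by (auto simp: G_def)
    then obtain Y where Y: "Y \<subseteq> G" "Y \<noteq> {}" "omega_resolvable_subset X Y"
      using local by blast
    have "disjnt G Z" if "Z \<in> M" for Z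
      using closure_of_subset[OF MX] that by (auto simp: G_def disjnt_def)
    then have disj: "disjnt Y Z" if "Z \<in> M" for Z
      using Y(1) that by (meson disjnt_subset1)
    \<comment> \<open>As a member of \<open>M\<close>, \<open>Y\<close> is disjoint from itself,
      hence empty.\<close>
    then have "Y \<in> M"
      using max Y(3) by (simp add: disjnt_sym)
    then show False
      using disj Y(2) by (auto simp: disjnt_def)
  qed
  \<comment> \<open>The \<open>n\<close>-th pieces of all members are joined. The closure of the
    union contains every member of \<open>M\<close>, hence the whole space.\<close>
  define D where "D n = (\<Union>Y\<in>M. f Y n)" for n
  have "dense_in_space X (D n)" for n
  proof -
    have "\<Union>M \<subseteq> X closure_of D n"
    proof
      fix x assume "x \<in> \<Union>M"
      then obtain Y where Y: "Y \<in> M" "x \<in> Y"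
        by blast
      then have "f Y n \<subseteq> D n"
        by (auto simp: D_def)
      then show "x \<in> X closure_of D n"
        using f(3)[OF Y(1)] Y(2) closure_of_mono by blast
    qed
    then have "topspace X \<subseteq> X closure_of D n"
      using closure_of_minimal dense by (metis closedin_closure_of)
    moreover have "D n \<subseteq> topspace X"
      using f(2) MX by (fastforce simp: D_def)
    ultimately show ?thesis
      by (simp add: closure_of_subset_topspace dense_in_space_def subset_antisym)
  qed
  moreover have "disjoint_family D"
    unfolding disjoint_family_on_def
  proof (intro ballI impI)
    fix m n :: nat assume "m \<noteq> n"
    have "f Y m \<inter> f Z n = {}" if "Y \<in> M" "Z \<in> M" for Y Z
    proof (cases "Y = Z")
      case True
      then show ?thesis
        using f(1)[OF that(1)] \<open>m \<noteq> n\<close> by (auto simp: disjoint_family_on_def)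
    next
      case False
      then have "Y \<inter> Z = {}"
        using M(2) that by (auto simp: pairwise_def disjnt_def)
      then show ?thesis
        using f(2)[OF that(1)] f(2)[OF that(2)] by blast
    qed
    then show "D m \<inter> D n = {}"
      by (auto simp: D_def)
  qed
  ultimately show ?thesis
    by (auto simp: resolvable_space_def)
qed

theorem corollary1p4:
  fixes X :: "'a topology"
  assumes "crowded_space X"
    and "monotonically_normal_space X"
  shows "omega_resolvable_space X"
proof (rule omega_resolvable_space_if_locally)
  fix G assume "openin X G" "G \<noteq> {}"
  then show "\<exists>Y \<subseteq> G. Y \<noteq> {} \<and> omega_resolvable_subset X Y"
    using omega_resolvable_subset_in_open[OF monotonically_normal_accumulates_separated[OF assms]]
    by metis
qed

end
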